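(* For $\Gamma>0$ and $\epsilon\in(0,\mathbb E[Y])$, let $R_\epsilon(\Gamma)$ be the rate achieved by the truncated Gaussian policy with parameter $\epsilon$ and buffer size $\Gamma$, namely $R_\epsilon(\Gamma)=I(X;W)$ where $E\sim\pi_\Gamma$ (the unique stationary distribution of the buffer chain defined in the context), $Y$ distributed as $Y_k$, $X'\sim\mathcal N(0,\mathbb E[Y]-\epsilon)$, $N\sim\mathcal N(0,\sigma^2)$, all independent, $X=\mathrm{sgn}(X')\min\{\sqrt{E+Y},|X'|\}$ and $W=X+N$. Let $R(\Gamma)=\sup_{\epsilon\in(0,\mathbb E[Y])}R_\epsilon(\Gamma)$. Then for each $\epsilon$, $\liminf_{\Gamma\to\infty}R_\epsilon(\Gamma)\ge \frac12\log\!\left(1+\frac{\mathbb E[Y]-\epsilon}{\sigma^2}\right)$, and $$\lim_{\Gamma\to\infty}R(\Gamma)=\frac12\log\!\left(1+\frac{\mathbb E[Y]}{\sigma^2}\right).$$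
   Context: $\{Y_k\}$ is an i.i.d. sequence of nonnegative random variables with $\mathbb E[Y_k^2]<\infty$ and $\mathbb E[Y_k]>0$; $\sigma^2>0$. For $\epsilon\in(0,\mathbb E[Y])$ let $\{X'_k\}$ be i.i.d. $\mathcal N(0,\mathbb E[Y]-\epsilon)$, independent of $\{Y_k\}$, and $\eta_k=Y_k-X_k'^2$ (so $\mathbb E[\eta_k]=\epsilon>0$). The truncated Gaussian policy transmits $X_k=\mathrm{sgn}(X'_k)\min\{\sqrt{E_k+Y_k},|X'_k|\}$ (with $\mathrm{sgn}(0)=0$), and the buffer chain with capacity $\Gamma$ is $E_{k+1}(\Gamma)=\min\{\Gamma,\max\{0,E_k(\Gamma)+\eta_{k+1}\}\}$, $E_0(\Gamma)\in[0,\Gamma]$. This chain has a unique stationary distribution $\pi_\Gamma$. *)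

theory Defs
  imports "HOL-Probability.Probability"
begin

definition gauss :: "real \<Rightarrow> real measure" where
  "gauss v = density lborel (normal_density 0 (sqrt v))"

definition meanY :: "real measure \<Rightarrow> real" where
  "meanY PY = (\<integral>y. y \<partial>PY)"

definition eta_law :: "real measure \<Rightarrow> real \<Rightarrow> real measure" where
  "eta_law PY eps = distr (PY \<Otimes>\<^sub>M gauss (meanY PY - eps)) borel (\<lambda>(y, x). y - x\<^sup>2)"

definition buf_step :: "real \<Rightarrow> real \<Rightarrow> real \<Rightarrow> real" where
  "buf_step Gam e eta = min Gam (max 0 (e + eta))"

definition stationary_buffer :: "real measure \<Rightarrow> real \<Rightarrow> real \<Rightarrow> real measure \<Rightarrow> bool" where
  "stationary_buffer PY eps Gam \<pi> \<longleftrightarrow>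
     prob_space \<pi> \<and> sets \<pi> = sets borel \<and> \<pi> {0..Gam} = 1 \<and>
     distr (\<pi> \<Otimes>\<^sub>M eta_law PY eps) borel (\<lambda>(e, eta). buf_step Gam e eta) = \<pi>"

definition tg_input :: "real \<Rightarrow> real \<Rightarrow> real \<Rightarrow> real" where
  "tg_input e y x' = sgn x' * min (sqrt (e + y)) \<bar>x'\<bar>"

definition tg_space :: "real measure \<Rightarrow> real \<Rightarrow> real \<Rightarrow> real measure \<Rightarrow> (real \<times> real \<times> real \<times> real) measure" where
  "tg_space PY s2 eps \<pi> = \<pi> \<Otimes>\<^sub>M (PY \<Otimes>\<^sub>M (gauss (meanY PY - eps) \<Otimes>\<^sub>M gauss s2))"

definition tg_rate :: "real measure \<Rightarrow> real \<Rightarrow> real \<Rightarrow> real measure \<Rightarrow> real" where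
  "tg_rate PY s2 eps \<pi> =
     prob_space.mutual_information (tg_space PY s2 eps \<pi>) (exp 1) borel borel
       (\<lambda>(e, y, x', n). tg_input e y x')
       (\<lambda>(e, y, x', n). tg_input e y x' + n)"

end

theory Submission
  imports Defs
begin

text \<open>Under \<open>\<pi>\<^sub>\<Gamma>\<close> the drift of \<open>\<eta> = Y - X'\<^sup>2\<close> is positive, so for small \<open>\<theta> > 0\<close> one has
  \<open>\<rho> = E exp (- \<theta> \<eta>) < 1\<close>, and stationarity applied to \<open>exp (- \<theta> E)\<close> gives
  \<open>E exp (- \<theta> E) \<le> exp (- \<theta> \<Gamma>) / (1 - \<rho>)\<close>. As \<open>X \<noteq> X'\<close> forces \<open>E + \<eta> < 0\<close>, Markov's
  inequality bounds the probability of truncation by \<open>\<rho> E exp (- \<theta> E)\<close>, which tends to 0.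
  Hence the density of \<open>W\<close> converges uniformly to that of \<open>X' + N\<close>, and Fatou's lemma
  bounds the liminf of the rate \<open>h(W) - h(N)\<close> from below. From above the rate is bounded
  by Gibbs' inequality, because \<open>E X\<^sup>2 \<le> E X'\<^sup>2\<close>.\<close>

subsection \<open>The additive Gaussian noise channel\<close>

lemma ln_normal_density:
  assumes "0 < s"
  shows "ln (normal_density x s w) = - ln (2 * pi * s\<^sup>2) / 2 - (w - x)\<^sup>2 / (2 * s\<^sup>2)"
proof -
  have "0 < 2 * pi * s\<^sup>2" using assms by simp
  then show ?thesis
    unfolding normal_density_def
    by (subst ln_mult) (auto simp: ln_div ln_sqrt)
qed

lemma normal_density_le:
  assumes "0 < s"
  shows "normal_density x s w \<le> 1 / sqrt (2 * pi * s\<^sup>2)"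
proof -
  have "- (w - x)\<^sup>2 / (2 * s\<^sup>2) \<le> 0" by (simp add: divide_nonpos_nonneg)
  then have "exp (- (w - x)\<^sup>2 / (2 * s\<^sup>2)) \<le> 1" by (simp only: exp_le_one_iff)
  then show ?thesis
    unfolding normal_density_def by (intro mult_left_le) auto
qed

lemma borel_measurable_normal_density_compose [measurable]:
  "(\<lambda>x. normal_density (f x) s (g x)) \<in> borel_measurable M"
  if [measurable]: "f \<in> borel_measurable M" "g \<in> borel_measurable M"
  unfolding normal_density_def by measurable

text \<open>Expand \<open>w\<^sup>2 = (w - x)\<^sup>2 + 2 * x * w - x\<^sup>2\<close>. The affine
  form in \<open>w\<^sup>2\<close> covers total mass and second moment at once, and the logarithm of
  a centred normal density also has this shape.\<close>

lemma normal_second_moment: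
  assumes "0 < s"
  shows "has_bochner_integral lborel (\<lambda>w. normal_density x s w * (a + b * w\<^sup>2)) (a + b * (s\<^sup>2 + x\<^sup>2))"
proof -
  have 1: "has_bochner_integral lborel (\<lambda>w. normal_density x s w * (w - x)\<^sup>2) (s\<^sup>2)"
    using normal_moment_even[OF assms, of x 1] by (simp add: fact_numeral)
  have 2: "has_bochner_integral lborel (\<lambda>w. normal_density x s w * w) x"
    using normal_moment_nz_1[OF assms, of x] .
  have 3: "has_bochner_integral lborel (\<lambda>w. normal_density x s w) 1"
    using assms by (simp add: has_bochner_integral_iff)
  have "has_bochner_integral lborel
      (\<lambda>w. b * (normal_density x s w * (w - x)\<^sup>2) + (2 * x * b) * (normal_density x s w * w)
        + (a - b * x\<^sup>2) * normal_density x s w)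
      (b * s\<^sup>2 + (2 * x * b) * x + (a - b * x\<^sup>2) * 1)"
    by (intro has_bochner_integral_add has_bochner_integral_mult_right 1 2 3)
  moreover have "b * s\<^sup>2 + (2 * x * b) * x + (a - b * x\<^sup>2) * 1 = a + b * (s\<^sup>2 + x\<^sup>2)"
    by (simp add: power2_eq_square algebra_simps)
  moreover have "(\<lambda>w. b * (normal_density x s w * (w - x)\<^sup>2) + (2 * x * b) * (normal_density x s w * w)
        + (a - b * x\<^sup>2) * normal_density x s w) = (\<lambda>w. normal_density x s w * (a + b * w\<^sup>2))"
    by (simp add: fun_eq_iff power2_eq_square algebra_simps)
  ultimately show ?thesis by metis
qed

text \<open>The value is minus the differential entropy of the noise. It does not depend on the
  shift \<open>x\<close>, so the entropy of the output given the input is h(N) whatever the input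
  law.\<close>

lemma normal_log_moment:
  assumes "0 < s"
  shows "has_bochner_integral lborel (\<lambda>w. normal_density x s w * ln (normal_density x s w))
    (- ln (2 * pi * s\<^sup>2) / 2 - 1 / 2)"
proof -
  have 1: "has_bochner_integral lborel (\<lambda>w. normal_density x s w * (w - x)\<^sup>2) (s\<^sup>2)"
    using normal_moment_even[OF assms, of x 1] by (simp add: fact_numeral)
  have 2: "has_bochner_integral lborel (\<lambda>w. normal_density x s w) 1"
    using assms by (simp add: has_bochner_integral_iff)
  have "has_bochner_integral lborel
      (\<lambda>w. (- ln (2 * pi * s\<^sup>2) / 2) * normal_density x s w
        - (1 / (2 * s\<^sup>2)) * (normal_density x s w * (w - x)\<^sup>2))
      ((- ln (2 * pi * s\<^sup>2) / 2) * 1 - (1 / (2 * s\<^sup>2)) * s\<^sup>2)"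
    by (intro has_bochner_integral_diff has_bochner_integral_mult_right 1 2)
  moreover have "(- ln (2 * pi * s\<^sup>2) / 2) * 1 - (1 / (2 * s\<^sup>2)) * s\<^sup>2 = - ln (2 * pi * s\<^sup>2) / 2 - 1 / 2"
    using assms by simp
  moreover have "(\<lambda>w. (- ln (2 * pi * s\<^sup>2) / 2) * normal_density x s w
        - (1 / (2 * s\<^sup>2)) * (normal_density x s w * (w - x)\<^sup>2))
      = (\<lambda>w. normal_density x s w * ln (normal_density x s w))"
    unfolding ln_normal_density[OF assms] by (simp add: fun_eq_iff algebra_simps)
  ultimately show ?thesis by metis
qed

text \<open>The output of the channel \<open>X \<mapsto> X + N\<close> with \<open>N\<close> normal of standard deviation \<open>s\<close>,
  when the input has law \<open>\<mu>\<close>.\<close>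

locale gaussian_channel = prob_space \<mu> for \<mu> :: "real measure" +
  fixes s :: real
  assumes sets_eq [measurable_cong]: "sets \<mu> = sets borel"
    and s_pos: "0 < s"
    and power_integrable: "integrable \<mu> (\<lambda>x. x\<^sup>2)"
begin

definition out_density :: "real \<Rightarrow> real" where
  "out_density w = (\<integral>x. normal_density x s w \<partial>\<mu>)"

definition in_power :: real where
  "in_power = (\<integral>x. x\<^sup>2 \<partial>\<mu>)"

definition out_entropy :: real where
  "out_entropy = - (\<integral>w. out_density w * ln (out_density w) \<partial>lborel)"

sublocale pair: pair_sigma_finite \<mu> lborel ..

lemma out_density_measurable [measurable]: "out_density \<in> borel_measurable borel"
  unfolding out_density_def by measurable

lemma integrable_kernel [simp]: "integrable \<mu> (\<lambda>x. normal_density x s w)"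
  by (rule integrable_const_bound[where B = "1 / sqrt (2 * pi * s\<^sup>2)"])
     (auto simp: normal_density_le[OF s_pos])

lemma out_density_nonneg: "0 \<le> out_density w"
  unfolding out_density_def by (simp add: integral_nonneg_AE)

lemma out_density_le: "out_density w \<le> 1 / sqrt (2 * pi * s\<^sup>2)"
  unfolding out_density_def
  by (rule integral_le_const) (auto simp: normal_density_le[OF s_pos])

lemma nn_integral_kernel: "(\<integral>\<^sup>+x. normal_density x s w \<partial>\<mu>) = ennreal (out_density w)"
  unfolding out_density_def by (rule nn_integral_eq_integral) auto

text \<open>Turns finite input power into a lower bound whose logarithm falls at most quadratically
  in \<open>w\<close>, so that second moments suffice to integrate the log density.\<close>

lemma out_density_ge:
  "exp (- ln (2 * pi * s\<^sup>2) / 2 - (w\<^sup>2 + in_power) / s\<^sup>2) \<le> out_density w"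
proof -
  \<comment> \<open>Jensen's inequality for \<open>exp\<close>, through its tangent line at \<open>c\<close>.\<close>
  define c where "c = - ln (2 * pi * s\<^sup>2) / 2 - (w\<^sup>2 + in_power) / s\<^sup>2"
  define z where "z = (\<lambda>x. - ln (2 * pi * s\<^sup>2) / 2 - (w\<^sup>2 + x\<^sup>2) / s\<^sup>2)"
  have [simp]: "integrable \<mu> z"
    unfolding z_def using power_integrable by auto
  have zint: "(\<integral>x. z x \<partial>\<mu>) = c"
    unfolding z_def c_def in_power_def using power_integrable
    by (simp add: prob_space)
  have "exp c * (1 + z x - c) \<le> normal_density x s w" for x
  proof -
    have "(w - x)\<^sup>2 \<le> 2 * (w\<^sup>2 + x\<^sup>2)"
      using zero_le_power2[of "w + x"] by (simp add: power2_eq_square algebra_simps)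
    then have "(w - x)\<^sup>2 / (2 * s\<^sup>2) \<le> 2 * (w\<^sup>2 + x\<^sup>2) / (2 * s\<^sup>2)"
      by (intro divide_right_mono) auto
    also have "\<dots> = (w\<^sup>2 + x\<^sup>2) / s\<^sup>2"
      by (rule mult_divide_mult_cancel_left) simp
    finally have "z x \<le> ln (normal_density x s w)"
      unfolding z_def by (subst ln_normal_density[OF s_pos]) simp
    then have "exp (z x) \<le> normal_density x s w"
      by (metis exp_le_cancel_iff exp_ln normal_density_pos s_pos)
    moreover have "exp c * (1 + (z x - c)) \<le> exp c * exp (z x - c)"
      by (intro mult_left_mono exp_ge_add_one_self) auto
    ultimately show ?thesis by (simp add: exp_diff add_diff_eq)
  qed
  then have "(\<integral>x. exp c * (1 + z x - c) \<partial>\<mu>) \<le> out_density w"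
    unfolding out_density_def by (intro integral_mono) auto
  moreover have "(\<integral>x. exp c * (1 + z x - c) \<partial>\<mu>) = exp c"
    by (simp add: prob_space zint)
  ultimately show ?thesis by (simp add: c_def)
qed

lemma out_density_pos: "0 < out_density w"
  using out_density_ge by (rule less_le_trans[rotated]) simp

lemma abs_ln_out_density_le:
  "\<bar>ln (out_density w)\<bar> \<le> \<bar>ln (2 * pi * s\<^sup>2)\<bar> / 2 + in_power / s\<^sup>2 + (1 / s\<^sup>2) * w\<^sup>2"
proof -
  have "0 \<le> in_power" unfolding in_power_def by simp
  then have *: "0 \<le> in_power / s\<^sup>2" "0 \<le> w\<^sup>2 / s\<^sup>2" by auto
  have "- ln (2 * pi * s\<^sup>2) / 2 - (w\<^sup>2 + in_power) / s\<^sup>2 \<le> ln (out_density w)"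
    using out_density_ge[of w] out_density_pos[of w] by (simp add: ln_ge_iff)
  moreover have "ln (out_density w) \<le> ln (1 / sqrt (2 * pi * s\<^sup>2))"
    using out_density_le[of w] out_density_pos[of w] s_pos by (subst ln_le_cancel_iff) auto
  moreover have "ln (1 / sqrt (2 * pi * s\<^sup>2)) = - ln (2 * pi * s\<^sup>2) / 2"
    using s_pos by (simp add: ln_div ln_sqrt)
  ultimately show ?thesis using * by (simp add: add_divide_distrib)
qed

lemma integrable_quadratic:
  "integrable (\<mu> \<Otimes>\<^sub>M lborel) (\<lambda>(x, w). normal_density x s w * (a + b * w\<^sup>2 + c * x\<^sup>2))"
proof -
  \<comment> \<open>With nonnegative coefficients the norm in Fubini's criterion is the function
    itself; other signs follow by domination.\<close>
  have *: "integrable (\<mu> \<Otimes>\<^sub>M lborel) (\<lambda>(x, w). normal_density x s w * (a + b * w\<^sup>2 + c * x\<^sup>2))"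
    if "0 \<le> a" "0 \<le> b" "0 \<le> c" for a b c :: real
  proof (rule pair.Fubini_integrable)
    have n: "norm (normal_density x s w * (a + b * w\<^sup>2 + c * x\<^sup>2))
        = normal_density x s w * ((a + c * x\<^sup>2) + b * w\<^sup>2)" for x w
      using that by (simp add: abs_mult)
    show "integrable \<mu> (\<lambda>x. \<integral>w. norm (case (x, w) of (x, w) \<Rightarrow> normal_density x s w * (a + b * w\<^sup>2 + c * x\<^sup>2)) \<partial>lborel)"
      unfolding prod.case n has_bochner_integral_integral_eq[OF normal_second_moment[OF s_pos]]
      using power_integrable by auto
    show "AE x in \<mu>. integrable lborel (\<lambda>w. case (x, w) of (x, w) \<Rightarrow> normal_density x s w * (a + b * w\<^sup>2 + c * x\<^sup>2))"
    proof (rule AE_I2)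
      fix x
      show "integrable lborel (\<lambda>w. case (x, w) of (x, w) \<Rightarrow> normal_density x s w * (a + b * w\<^sup>2 + c * x\<^sup>2))"
        using normal_second_moment[OF s_pos, of x "a + c * x\<^sup>2" b]
        by (simp add: has_bochner_integral_iff algebra_simps)
    qed
  qed measurable
  show ?thesis
    by (rule Bochner_Integration.integrable_bound[OF *[of "\<bar>a\<bar>" "\<bar>b\<bar>" "\<bar>c\<bar>"]])
       (auto simp: abs_mult intro!: AE_I2 mult_left_mono
         order_trans[OF abs_triangle_ineq] add_mono)
qed

lemma integrable_bounded_by_quadratic:
  assumes [measurable]: "(\<lambda>(x, w). g x w) \<in> borel_measurable (borel \<Otimes>\<^sub>M borel)"
    and g: "\<And>x w. \<bar>g x w\<bar> \<le> a + b * w\<^sup>2 + c * x\<^sup>2"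
  shows "integrable (\<mu> \<Otimes>\<^sub>M lborel) (\<lambda>(x, w). normal_density x s w * g x w)"
proof (rule Bochner_Integration.integrable_bound[OF integrable_quadratic[of a b c]])
  show "AE z in \<mu> \<Otimes>\<^sub>M lborel. norm (case z of (x, w) \<Rightarrow> normal_density x s w * g x w)
      \<le> norm (case z of (x, w) \<Rightarrow> normal_density x s w * (a + b * w\<^sup>2 + c * x\<^sup>2))"
    using g by (auto simp: abs_mult intro!: AE_I2 mult_left_mono order_trans[OF g] abs_ge_self)
qed measurable

text \<open>A factor depending on the output alone comes out of the integral over the input; Fubini
  then turns the kernel into \<open>out_density\<close>.\<close>

lemma
  assumes [measurable]: "g \<in> borel_measurable borel"
    and g: "\<And>w. \<bar>g w\<bar> \<le> a + b * w\<^sup>2"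
  shows integrable_out_density_mult: "integrable lborel (\<lambda>w. out_density w * g w)" (is ?I)
    and integral_out_density_mult:
      "(\<integral>(x, w). normal_density x s w * g w \<partial>(\<mu> \<Otimes>\<^sub>M lborel)) = (\<integral>w. out_density w * g w \<partial>lborel)" (is ?E)
proof -
  have i: "integrable (\<mu> \<Otimes>\<^sub>M lborel) (\<lambda>(x, w). normal_density x s w * g w)"
    using g by (intro integrable_bounded_by_quadratic[where a = a and b = b and c = 0]) auto
  have e: "(\<integral>x. normal_density x s w * g w \<partial>\<mu>) = out_density w * g w" for w
    unfolding out_density_def by simp
  show ?I using pair.integrable_snd[OF i] unfolding prod.case e .
  show ?E using pair.integral_snd[OF i] unfolding prod.case e by simp
qed

lemma integral_quadratic_out:
  "(\<integral>w. out_density w * (a + b * w\<^sup>2) \<partial>lborel) = a + b * (s\<^sup>2 + in_power)"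
proof -
  have "\<bar>a + b * w\<^sup>2\<bar> \<le> \<bar>a\<bar> + \<bar>b\<bar> * w\<^sup>2" for w
    by (rule order_trans[OF abs_triangle_ineq]) (simp add: abs_mult)
  then have "(\<integral>w. out_density w * (a + b * w\<^sup>2) \<partial>lborel)
      = (\<integral>(x, w). normal_density x s w * (a + b * w\<^sup>2) \<partial>(\<mu> \<Otimes>\<^sub>M lborel))"
    by (intro integral_out_density_mult[symmetric]) auto
  also have "\<dots> = (\<integral>x. \<integral>w. normal_density x s w * (a + b * w\<^sup>2) \<partial>lborel \<partial>\<mu>)"
    using integrable_quadratic[of a b 0] by (intro pair.integral_fst[symmetric]) simp
  also have "\<dots> = (\<integral>x. a + b * (s\<^sup>2 + x\<^sup>2) \<partial>\<mu>)"
    by (simp add: has_bochner_integral_integral_eq[OF normal_second_moment[OF s_pos]])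
  also have "\<dots> = a + b * (s\<^sup>2 + in_power)"
    unfolding in_power_def using power_integrable by (simp add: prob_space algebra_simps)
  finally show ?thesis .
qed

lemma integrable_entropy: "integrable lborel (\<lambda>w. out_density w * ln (out_density w))"
  using abs_ln_out_density_le by (rule integrable_out_density_mult[rotated]) measurable

lemma integrable_quadratic_out: "integrable lborel (\<lambda>w. out_density w * (a + b * w\<^sup>2))"
proof (rule integrable_out_density_mult)
  show "\<bar>a + b * w\<^sup>2\<bar> \<le> \<bar>a\<bar> + \<bar>b\<bar> * w\<^sup>2" for w
    by (rule order_trans[OF abs_triangle_ineq]) (simp add: abs_mult)
qed measurable

text \<open>Maximum entropy under a power constraint: compare with the centred normal density of
  variance \<open>v + s\<^sup>2\<close>. Its logarithm is affine in \<open>w\<^sup>2\<close>, so the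
  cross entropy sees the output only through its second moment.\<close>

lemma out_entropy_le:
  assumes "in_power \<le> v"
  shows "out_entropy \<le> ln (2 * pi * (v + s\<^sup>2)) / 2 + 1 / 2"
proof -
  define t where "t = v + s\<^sup>2"
  have "0 \<le> in_power" unfolding in_power_def by simp
  then have t: "0 < t" using assms s_pos unfolding t_def by (smt (verit) zero_less_power)
  define g where "g = normal_density 0 (sqrt t)"
  define l where "l = (\<lambda>w. - ln (2 * pi * t) / 2 + (- 1 / (2 * t)) * w\<^sup>2)"
  have lg: "l w = ln (g w)" for w
    unfolding l_def g_def using t by (subst ln_normal_density) auto
  \<comment> \<open>Gibbs' inequality pointwise, from \<open>ln z \<le> z - 1\<close> at
    \<open>z = g w / out_density w\<close>; the right side integrates to 0, as both densities have
    mass 1.\<close>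
  have "out_density w * l w - out_density w * ln (out_density w) \<le> g w - out_density w" for w
  proof -
    have g: "0 < g w" using t by (simp add: g_def normal_density_pos)
    have "ln (g w / out_density w) \<le> g w / out_density w - 1"
      using g out_density_pos[of w] by (intro ln_le_minus_one) auto
    then have "out_density w * ln (g w / out_density w) \<le> out_density w * (g w / out_density w - 1)"
      using out_density_nonneg by (intro mult_left_mono) auto
    then show ?thesis
      using g out_density_pos[of w] by (simp add: lg ln_div algebra_simps)
  qed
  moreover have "integrable lborel (\<lambda>w. out_density w * l w)"
    unfolding l_def by (rule integrable_quadratic_out)
  moreover have gi: "integrable lborel g" "(\<integral>w. g w \<partial>lborel) = 1" unfolding g_def using t by auto
  moreover have oi: "integrable lborel out_density" "(\<integral>w. out_density w \<partial>lborel) = 1"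
    using integrable_quadratic_out[of 1 0] integral_quadratic_out[of 1 0] by auto
  ultimately have "(\<integral>w. out_density w * l w - out_density w * ln (out_density w) \<partial>lborel)
      \<le> (\<integral>w. g w - out_density w \<partial>lborel)"
    by (intro integral_mono Bochner_Integration.integrable_diff integrable_entropy)
  also have "\<dots> = 0" using gi oi by simp
  also have "(\<integral>w. out_density w * l w - out_density w * ln (out_density w) \<partial>lborel)
      = (\<integral>w. out_density w * l w \<partial>lborel) + out_entropy"
    unfolding out_entropy_def l_def
    by (subst Bochner_Integration.integral_diff[OF integrable_quadratic_out integrable_entropy]) simp
  also have "(\<integral>w. out_density w * l w \<partial>lborel) = - ln (2 * pi * t) / 2 + (- 1 / (2 * t)) * (s\<^sup>2 + in_power)"
    unfolding l_def by (rule integral_quadratic_out)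
  finally have "out_entropy \<le> ln (2 * pi * t) / 2 + (s\<^sup>2 + in_power) / (2 * t)" by simp
  moreover have "(s\<^sup>2 + in_power) / (2 * t) \<le> 1 / 2"
    using t assms by (simp add: t_def divide_simps)
  ultimately show ?thesis unfolding t_def by linarith
qed

text \<open>The equality case of \<open>out_entropy_le\<close>: the cross entropy with the
  comparison density is the entropy itself.\<close>

lemma out_entropy_normal:
  assumes "out_density = normal_density 0 (sqrt t)" and "t = in_power + s\<^sup>2"
  shows "out_entropy = ln (2 * pi * t) / 2 + 1 / 2"
proof -
  have "0 \<le> in_power" unfolding in_power_def by simp
  then have t: "0 < t" using assms(2) s_pos by (smt (verit) zero_less_power)
  have "ln (out_density w) = - ln (2 * pi * t) / 2 + (- 1 / (2 * t)) * w\<^sup>2" for w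
    using t by (simp add: assms(1) ln_normal_density)
  then have "out_entropy = - (\<integral>w. out_density w * (- ln (2 * pi * t) / 2 + (- 1 / (2 * t)) * w\<^sup>2) \<partial>lborel)"
    unfolding out_entropy_def by simp
  also have "\<dots> = ln (2 * pi * t) / 2 + (s\<^sup>2 + in_power) / (2 * t)"
    unfolding integral_quadratic_out by simp
  also have "(s\<^sup>2 + in_power) / (2 * t) = 1 / 2" using t by (simp add: assms(2) field_simps)
  finally show ?thesis .
qed

end

section \<open>Mutual information as a difference of entropies\<close>

text \<open>Given \<open>X = x\<close> the output is the noise shifted by \<open>x\<close>. The law
  of \<open>X\<close> itself is the reference measure on the input side, because an input produced
  by truncation can have atoms.\<close>

lemma (in prob_space) distributed_additive_gaussian:
  assumes X [measurable]: "X \<in> borel_measurable M" and Z [measurable]: "Z \<in> borel_measurable M"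
    and s: "0 < s"
    and indep: "distr M (borel \<Otimes>\<^sub>M borel) (\<lambda>\<omega>. (X \<omega>, Z \<omega>))
      = distr M borel X \<Otimes>\<^sub>M density lborel (normal_density 0 s)"
  shows "distributed M (distr M borel X \<Otimes>\<^sub>M lborel) (\<lambda>\<omega>. (X \<omega>, X \<omega> + Z \<omega>))
    (\<lambda>(x, w). normal_density x s w)"
proof -
  let ?\<mu> = "distr M borel X" and ?G = "density lborel (normal_density 0 s)"
  interpret G: prob_space ?G using s by (rule prob_space_normal_density)
  interpret m: prob_space ?\<mu> by (rule prob_space_distr) simp
  interpret G': pair_sigma_finite ?\<mu> ?G ..
  have "distr M (?\<mu> \<Otimes>\<^sub>M lborel) (\<lambda>\<omega>. (X \<omega>, X \<omega> + Z \<omega>))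
      = density (?\<mu> \<Otimes>\<^sub>M lborel) (\<lambda>(x, w). normal_density x s w)" (is "?L = ?R")
  proof (rule measure_eqI)
    fix A assume "A \<in> sets ?L"
    then have A [measurable]: "A \<in> sets (borel \<Otimes>\<^sub>M borel)"
      by (simp cong: sets_pair_measure_cong)
    have "emeasure ?L A = (\<integral>\<^sup>+\<omega>. indicator A (X \<omega>, X \<omega> + Z \<omega>) \<partial>M)"
      unfolding nn_integral_indicator[OF \<open>A \<in> sets ?L\<close>, symmetric]
      by (subst nn_integral_distr) (auto cong: measurable_cong_sets sets_pair_measure_cong)
    also have "\<dots> = (\<integral>\<^sup>+y. indicator A (fst y, fst y + snd y) \<partial>distr M (borel \<Otimes>\<^sub>M borel) (\<lambda>\<omega>. (X \<omega>, Z \<omega>)))"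
      by (subst nn_integral_distr) auto
    also have "\<dots> = (\<integral>\<^sup>+x. \<integral>\<^sup>+z. indicator A (x, x + z) \<partial>?G \<partial>?\<mu>)"
      unfolding indep by (subst G.nn_integral_fst[symmetric]) auto
    also have "\<dots> = (\<integral>\<^sup>+x. \<integral>\<^sup>+w. ennreal (normal_density x s w) * indicator A (x, w) \<partial>lborel \<partial>?\<mu>)"
    proof (rule nn_integral_cong)
      fix x
      \<comment> \<open>Substituting \<open>w = x + z\<close> turns the density centred at
        \<open>x\<close> into the one centred at 0.\<close>
      have "(\<integral>\<^sup>+w. ennreal (normal_density x s w) * indicator A (x, w) \<partial>lborel)
        = (\<integral>\<^sup>+w. ennreal (normal_density x s (x + 1 * w)) * indicator A (x, x + 1 * w) \<partial>lborel)"
        by (subst nn_integral_real_affine[where c = 1 and t = x]) auto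
      also have "\<dots> = (\<integral>\<^sup>+z. indicator A (x, x + z) \<partial>?G)"
        by (subst nn_integral_density) (auto simp: normal_density_def)
      finally show "(\<integral>\<^sup>+z. indicator A (x, x + z) \<partial>?G)
        = (\<integral>\<^sup>+w. ennreal (normal_density x s w) * indicator A (x, w) \<partial>lborel)" ..
    qed
    also have "\<dots> = (\<integral>\<^sup>+y. ennreal (case y of (x, w) \<Rightarrow> normal_density x s w) * indicator A y \<partial>(?\<mu> \<Otimes>\<^sub>M lborel))"
      by (subst lborel.nn_integral_fst[symmetric]) auto
    also have "\<dots> = emeasure ?R A"
      by (subst emeasure_density) (auto cong: sets_pair_measure_cong simp: split_beta')
    finally show "emeasure ?L A = emeasure ?R A" .
  qed simp
  then show ?thesis
    unfolding distributed_def by (auto simp: split_beta')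
qed

text \<open>The identity I(X;W) = h(W) - h(N): the log density ratio splits into a noise term, whose
  integral does not depend on the input law, and the log output density. Quadratic bounds make both
  parts integrable.\<close>

lemma (in prob_space) mutual_information_additive_gaussian:
  assumes X [measurable]: "X \<in> borel_measurable M" and Z [measurable]: "Z \<in> borel_measurable M"
    and s: "0 < s" and int: "integrable M (\<lambda>\<omega>. (X \<omega>)\<^sup>2)"
    and indep: "distr M (borel \<Otimes>\<^sub>M borel) (\<lambda>\<omega>. (X \<omega>, Z \<omega>))
      = distr M borel X \<Otimes>\<^sub>M density lborel (normal_density 0 s)"
  shows "mutual_information (exp 1) borel borel X (\<lambda>\<omega>. X \<omega> + Z \<omega>)
    = gaussian_channel.out_entropy (distr M borel X) s - (ln (2 * pi * s\<^sup>2) / 2 + 1 / 2)"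
proof -
  let ?\<mu> = "distr M borel X" and ?W = "\<lambda>\<omega>. X \<omega> + Z \<omega>"
  interpret m: gaussian_channel ?\<mu> s
    by (intro gaussian_channel.intro gaussian_channel_axioms.intro prob_space_distr)
       (use s int in \<open>simp_all add: integrable_distr_eq\<close>)
  interpret information_space M "exp 1" by unfold_locales simp
  let ?p = "m.out_density" and ?n = "\<lambda>(x, w). normal_density x s w"
  have J: "distributed M (?\<mu> \<Otimes>\<^sub>M lborel) (\<lambda>\<omega>. (X \<omega>, ?W \<omega>)) ?n"
    using distributed_additive_gaussian[OF X Z s indep] by (simp add: split_beta')
  have PW: "distributed M lborel ?W ?p"
    using distr_marginal2[OF m.sigma_finite_measure_axioms lborel.sigma_finite_measure_axioms J]
    by (simp add: m.nn_integral_kernel)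
  have PX: "distributed M ?\<mu> X (\<lambda>_. ennreal 1)"
    unfolding distributed_def using distr_cong[of M M ?\<mu> borel X X] by (simp add: density_1)
  define f where "f = (\<lambda>(x, w). normal_density x s w * ln (normal_density x s w / ?p w))"
  \<comment> \<open>Mutual information sees the target spaces only through their sigma-algebras, so
    \<open>borel\<close> may be replaced by the measures with respect to which the densities are
    taken.\<close>
  have "mutual_information (exp 1) borel borel X ?W = mutual_information (exp 1) ?\<mu> lborel X ?W"
    unfolding mutual_information_def by (simp cong: distr_cong sets_pair_measure_cong)
  also have "\<dots> = integral\<^sup>L (?\<mu> \<Otimes>\<^sub>M lborel) f"
    by (subst mutual_information_distr[OF m.sigma_finite_measure_axioms lborel.sigma_finite_measure_axioms,
          of X "\<lambda>_. 1" ?W ?p ?n])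
       (use PX PW J in \<open>auto simp: m.out_density_nonneg f_def log_def split_beta'\<close>)
  finally have I: "mutual_information (exp 1) borel borel X ?W = integral\<^sup>L (?\<mu> \<Otimes>\<^sub>M lborel) f" .
  have i1: "integrable (?\<mu> \<Otimes>\<^sub>M lborel) (\<lambda>(x, w). normal_density x s w * ln (normal_density x s w))"
  proof (rule m.integrable_bounded_by_quadratic)
    fix x w
    have "(w - x)\<^sup>2 / (2 * s\<^sup>2) \<le> 2 * (w\<^sup>2 + x\<^sup>2) / (2 * s\<^sup>2)"
      using zero_le_power2[of "w + x"]
      by (intro divide_right_mono) (auto simp: power2_eq_square algebra_simps)
    also have "\<dots> = (w\<^sup>2 + x\<^sup>2) / s\<^sup>2"
      by (rule mult_divide_mult_cancel_left) simp
    finally have "(w - x)\<^sup>2 / (2 * s\<^sup>2) \<le> (1 / s\<^sup>2) * w\<^sup>2 + (1 / s\<^sup>2) * x\<^sup>2"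
      by (simp add: add_divide_distrib)
    moreover have "0 \<le> (w - x)\<^sup>2 / (2 * s\<^sup>2)" by simp
    ultimately show "\<bar>ln (normal_density x s w)\<bar>
        \<le> \<bar>ln (2 * pi * s\<^sup>2)\<bar> / 2 + (1 / s\<^sup>2) * w\<^sup>2 + (1 / s\<^sup>2) * x\<^sup>2"
      unfolding ln_normal_density[OF s] by linarith
  qed measurable
  have i2: "integrable (?\<mu> \<Otimes>\<^sub>M lborel) (\<lambda>(x, w). normal_density x s w * ln (?p w))"
    using m.abs_ln_out_density_le
    by (intro m.integrable_bounded_by_quadratic
          [where a = "\<bar>ln (2 * pi * s\<^sup>2)\<bar> / 2 + m.in_power / s\<^sup>2" and b = "1 / s\<^sup>2" and c = 0]) auto
  note I
  also have "f = (\<lambda>y. (case y of (x, w) \<Rightarrow> normal_density x s w * ln (normal_density x s w))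
      - (case y of (x, w) \<Rightarrow> normal_density x s w * ln (?p w)))"
    unfolding f_def
    using normal_density_pos[OF s, THEN less_imp_neq, symmetric]
      m.out_density_pos[THEN less_imp_neq, symmetric] normal_density_pos[OF s] m.out_density_pos
    by (simp add: fun_eq_iff ln_div algebra_simps)
  also have "integral\<^sup>L (?\<mu> \<Otimes>\<^sub>M lborel) \<dots>
      = (\<integral>(x, w). normal_density x s w * ln (normal_density x s w) \<partial>(?\<mu> \<Otimes>\<^sub>M lborel))
        - (\<integral>(x, w). normal_density x s w * ln (?p w) \<partial>(?\<mu> \<Otimes>\<^sub>M lborel))"
    by (intro Bochner_Integration.integral_diff i1 i2)
  also have "(\<integral>(x, w). normal_density x s w * ln (normal_density x s w) \<partial>(?\<mu> \<Otimes>\<^sub>M lborel))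
      = - ln (2 * pi * s\<^sup>2) / 2 - 1 / 2"
    by (subst m.pair.integral_fst[OF i1, symmetric])
       (simp add: has_bochner_integral_integral_eq[OF normal_log_moment[OF s]] m.prob_space[simplified])
  also have "(\<integral>(x, w). normal_density x s w * ln (?p w) \<partial>(?\<mu> \<Otimes>\<^sub>M lborel)) = - m.out_entropy"
    unfolding m.out_entropy_def minus_minus
    by (rule m.integral_out_density_mult[OF _ m.abs_ln_out_density_le]) measurable
  finally show ?thesis by simp
qed

section \<open>Lower semicontinuity of the output entropy\<close>

text \<open>As \<open>out_density\<close> has mass 1, adding the log peak \<open>L\<close> of the
  noise density writes the entropy as the integral of a nonnegative function. The sign of the sum
  shows that \<open>ennreal\<close> does not truncate it.\<close>

lemma (in gaussian_channel)
  fixes L :: real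
  defines "L \<equiv> ln (1 / sqrt (2 * pi * s\<^sup>2))"
  shows nn_integral_entropy:
      "(\<integral>\<^sup>+w. ennreal (out_density w * (L - ln (out_density w))) \<partial>lborel) = ennreal (L + out_entropy)"
    and out_entropy_ge: "0 \<le> L + out_entropy"
proof -
  have le: "ln (out_density w) \<le> L" for w
    unfolding L_def using out_density_le[of w] out_density_pos[of w] s_pos
    by (subst ln_le_cancel_iff) auto
  have oi: "integrable lborel out_density" "(\<integral>w. out_density w \<partial>lborel) = 1"
    using integrable_quadratic_out[of 1 0] integral_quadratic_out[of 1 0] by auto
  have eq: "(\<lambda>w. out_density w * (L - ln (out_density w)))
      = (\<lambda>w. L * out_density w - out_density w * ln (out_density w))"
    by (simp add: fun_eq_iff algebra_simps)
  have i: "integrable lborel (\<lambda>w. out_density w * (L - ln (out_density w)))"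
    unfolding eq using oi integrable_entropy by auto
  have I: "(\<integral>w. out_density w * (L - ln (out_density w)) \<partial>lborel) = L + out_entropy"
    unfolding eq using oi integrable_entropy by (simp add: out_entropy_def)
  have nn: "0 \<le> out_density w * (L - ln (out_density w))" for w
    using le[of w] out_density_nonneg[of w] by simp
  show "(\<integral>\<^sup>+w. ennreal (out_density w * (L - ln (out_density w))) \<partial>lborel) = ennreal (L + out_entropy)"
    using nn_integral_eq_integral[OF i] nn I by simp
  show "0 \<le> L + out_entropy"
    unfolding I[symmetric] using nn by simp
qed

text \<open>Since \<open>out_density\<close> is bounded by the peak \<open>exp L\<close> of the noise density, the integrand
  \<open>out_density w * (L - ln (out_density w))\<close> is nonnegative and Fatou's lemma applies without
  any uniform integrability.\<close>

lemma out_entropy_lower_semicontinuous: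
  assumes \<nu>: "gaussian_channel \<nu> s" and c: "c < gaussian_channel.out_entropy \<nu> s"
  shows "\<exists>d>0. \<forall>\<mu>. gaussian_channel \<mu> s \<longrightarrow>
    (\<forall>w. \<bar>gaussian_channel.out_density \<mu> s w - gaussian_channel.out_density \<nu> s w\<bar> \<le> d) \<longrightarrow>
    c < gaussian_channel.out_entropy \<mu> s"
proof (rule ccontr)
  interpret \<nu>: gaussian_channel \<nu> s by fact
  let ?p = "\<lambda>\<mu>. gaussian_channel.out_density \<mu> s" and ?h = "\<lambda>\<mu>. gaussian_channel.out_entropy \<mu> s"
  assume contra: "\<not> ?thesis"
  \<comment> \<open>If every tolerance \<open>1 / (k + 1)\<close> fails, there are input laws with
    uniformly converging output densities and entropies at most \<open>c\<close>.\<close>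
  have "\<exists>\<mu>. gaussian_channel \<mu> s \<and> (\<forall>w. \<bar>?p \<mu> w - ?p \<nu> w\<bar> \<le> inverse (real (Suc k))) \<and> ?h \<mu> \<le> c" for k
    using contra not_less by (metis inverse_positive_iff_positive of_nat_0_less_iff zero_less_Suc)
  then obtain \<mu> where \<mu>: "\<And>k. gaussian_channel (\<mu> k) s"
    and close: "\<And>k w. \<bar>?p (\<mu> k) w - ?p \<nu> w\<bar> \<le> inverse (real (Suc k))"
    and le: "\<And>k. ?h (\<mu> k) \<le> c"
    by metis
  define L where "L = ln (1 / sqrt (2 * pi * s\<^sup>2))"
  define f where "f = (\<lambda>t. t * (L - ln t))"
  have [measurable]: "f \<in> borel_measurable borel" "?p (\<mu> k) \<in> borel_measurable borel" for k
    using gaussian_channel.out_density_measurable[OF \<mu>] unfolding f_def by auto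
  have "(\<lambda>k. ennreal (f (?p (\<mu> k) w))) \<longlonglongrightarrow> ennreal (f (?p \<nu> w))" for w
  proof -
    have "(\<lambda>k. ?p (\<mu> k) w - ?p \<nu> w) \<longlonglongrightarrow> 0"
      by (rule Lim_null_comparison[OF _ LIMSEQ_inverse_real_of_nat]) (simp only: real_norm_def close eventually_True)
    then have "(\<lambda>k. ?p (\<mu> k) w) \<longlonglongrightarrow> ?p \<nu> w" by (simp add: LIM_zero_iff)
    then show ?thesis
      unfolding f_def using \<nu>.out_density_pos[of w] by (intro tendsto_intros) auto
  qed
  then have "(\<integral>\<^sup>+w. f (?p \<nu> w) \<partial>lborel) = (\<integral>\<^sup>+w. liminf (\<lambda>k. ennreal (f (?p (\<mu> k) w))) \<partial>lborel)"
    by (intro nn_integral_cong lim_imp_Liminf[symmetric]) auto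
  also have "\<dots> \<le> liminf (\<lambda>k. \<integral>\<^sup>+w. f (?p (\<mu> k) w) \<partial>lborel)"
    by (rule nn_integral_liminf) measurable
  also have "\<dots> \<le> liminf (\<lambda>k. ennreal (L + c))"
    unfolding f_def L_def gaussian_channel.nn_integral_entropy[OF \<mu>] using le
    by (intro Liminf_mono always_eventually allI ennreal_leI) simp
  also have "\<dots> = ennreal (L + c)" by (simp add: Liminf_const)
  finally have "ennreal (L + \<nu>.out_entropy) \<le> ennreal (L + c)"
    unfolding f_def L_def \<nu>.nn_integral_entropy .
  \<comment> \<open>Since \<open>ennreal\<close> sends negative reals to 0, the comparison returns
    to the reals only with a nonnegative right side.\<close>
  moreover have "0 \<le> L + c"
    using gaussian_channel.out_entropy_ge[OF \<mu>, of 0] le[of 0] by (simp add: L_def)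
  ultimately show False using c by simp
qed

subsection \<open>Gaussian inputs and exponential moments\<close>

lemma sets_gauss [simp, measurable_cong]: "sets (gauss v) = sets borel"
  by (simp add: gauss_def)

lemma space_gauss [simp]: "space (gauss v) = UNIV"
  by (simp add: gauss_def)

lemma prob_space_gauss: "0 < v \<Longrightarrow> prob_space (gauss v)"
  unfolding gauss_def by (rule prob_space_normal_density) simp

lemma gauss_second_moment:
  assumes "0 < v"
  shows "has_bochner_integral (gauss v) (\<lambda>x. x\<^sup>2) v"
  unfolding gauss_def
  using normal_second_moment[of "sqrt v" 0 0 1] assms
  by (subst has_bochner_integral_density) (auto simp: mult.commute)

lemma gaussian_channel_gauss:
  assumes "0 < v" "0 < s"
  shows "gaussian_channel (gauss v) s"
  using assms gauss_second_moment[OF assms(1)] prob_space_gauss[OF assms(1)]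
  by (auto simp: gaussian_channel_def gaussian_channel_axioms_def has_bochner_integral_iff)

text \<open>Variances add when normal densities are convolved, so the output is normal and the
  equality case of the entropy bound applies.\<close>

lemma out_entropy_gauss:
  assumes v: "0 < v" and s: "0 < s"
  shows "gaussian_channel.out_entropy (gauss v) s = ln (2 * pi * (v + s\<^sup>2)) / 2 + 1 / 2"
proof -
  interpret g: gaussian_channel "gauss v" s using assms by (rule gaussian_channel_gauss)
  have "ennreal (g.out_density w) = ennreal (normal_density 0 (sqrt (s\<^sup>2 + (sqrt v)\<^sup>2)) w)" for w
  proof -
    have "ennreal (g.out_density w) = (\<integral>\<^sup>+x. normal_density x s w \<partial>gauss v)"
      by (rule g.nn_integral_kernel[symmetric])
    also have "\<dots> = (\<integral>\<^sup>+x. ennreal (normal_density 0 s (w - x) * normal_density 0 (sqrt v) x) \<partial>lborel)"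
      unfolding gauss_def
      by (subst nn_integral_density)
         (auto simp: ennreal_mult' [symmetric] normal_density_def mult.commute intro!: nn_integral_cong)
    also have "\<dots> = ennreal (normal_density 0 (sqrt (s\<^sup>2 + (sqrt v)\<^sup>2)) w)"
      using conv_normal_density_zero_mean[of s "sqrt v"] s v by (simp add: fun_eq_iff)
    finally show ?thesis .
  qed
  then have "g.out_density = normal_density 0 (sqrt (v + s\<^sup>2))"
    using v by (simp add: fun_eq_iff g.out_density_nonneg add.commute)
  moreover have "g.in_power = v"
    unfolding g.in_power_def using gauss_second_moment[OF v] by (rule has_bochner_integral_integral_eq)
  ultimately show ?thesis by (intro g.out_entropy_normal) auto
qed

text \<open>With \<open>a = 1 - 2 * \<theta> * v\<close>, the weight
  \<open>exp (\<theta> * x\<^sup>2)\<close> turns the normal density of variance \<open>v\<close>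
  into \<open>1 / sqrt a\<close> times the one of variance \<open>v / a\<close>.\<close>

lemma gauss_exp_moment:
  assumes v: "0 < v" and \<theta>: "2 * \<theta> * v < 1"
  shows "(\<integral>\<^sup>+x. ennreal (exp (\<theta> * x\<^sup>2)) \<partial>gauss v) = ennreal (1 / sqrt (1 - 2 * \<theta> * v))"
proof -
  define a where "a = 1 - 2 * \<theta> * v"
  have a: "0 < a" using \<theta> by (simp add: a_def)
  have "normal_density 0 (sqrt v) x * exp (\<theta> * x\<^sup>2) = 1 / sqrt a * normal_density 0 (sqrt (v / a)) x" for x
  proof -
    have "- x\<^sup>2 / (2 * v) + \<theta> * x\<^sup>2 = - x\<^sup>2 / (2 * (v / a))"
      using v a by (simp add: a_def field_simps)
    moreover have "1 / sqrt a * (1 / sqrt (2 * pi * (v / a))) = 1 / sqrt (2 * pi * v)"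
      using v a by (simp add: real_sqrt_divide real_sqrt_mult)
    ultimately show ?thesis
      using v a unfolding normal_density_def by (simp add: exp_add[symmetric])
  qed
  then have "(\<integral>\<^sup>+x. ennreal (exp (\<theta> * x\<^sup>2)) \<partial>gauss v)
      = (\<integral>\<^sup>+x. ennreal (1 / sqrt a * normal_density 0 (sqrt (v / a)) x) \<partial>lborel)"
    unfolding gauss_def
    by (subst nn_integral_density) (auto simp: ennreal_mult'[symmetric] intro!: nn_integral_cong)
  also have "\<dots> = ennreal (1 / sqrt a)"
    using v a by (subst nn_integral_eq_integral) auto
  finally show ?thesis by (simp add: a_def)
qed

lemma ln_capacity:
  fixes v s2 :: real
  assumes "0 < v" "0 < s2"
  shows "ln (2 * pi * (v + s2)) / 2 - ln (2 * pi * s2) / 2 = 1/2 * ln (1 + v / s2)"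
proof -
  have "ln (2 * pi * (v + s2)) - ln (2 * pi * s2) = ln (2 * pi * (v + s2) / (2 * pi * s2))"
    using assms by (subst ln_div) auto
  also have "2 * pi * (v + s2) / (2 * pi * s2) = 1 + v / s2"
    using assms by (simp add: field_simps)
  finally show ?thesis by simp
qed

text \<open>Since (1 - x + x^2/2) (1 + x + x^2/2) = 1 + x^4/4, the Taylor lower bound for
  \<open>exp x\<close> becomes an upper bound for its reciprocal.\<close>

lemma exp_minus_le_quadratic:
  fixes x :: real
  assumes "0 \<le> x"
  shows "exp (- x) \<le> 1 - x + x\<^sup>2 / 2"
proof -
  have q: "1 + x + x\<^sup>2 / 2 \<le> exp x" by (rule exp_lower_Taylor_quadratic[OF assms])
  have "1 \<le> (1 - x + x\<^sup>2 / 2) * (1 + x + x\<^sup>2 / 2)"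
    using zero_le_power2[of "x\<^sup>2"] by (simp add: power2_eq_square algebra_simps)
  also have "\<dots> \<le> (1 - x + x\<^sup>2 / 2) * exp x"
    using q zero_le_power2[of "1 - x"] by (intro mult_left_mono) (auto simp: power2_eq_square algebra_simps)
  finally show ?thesis by (simp add: exp_minus field_simps)
qed

subsection \<open>The truncated Gaussian policy\<close>

locale tg_policy = PY: prob_space PY for PY :: "real measure" +
  fixes s2 eps :: real
  assumes sets_PY [measurable_cong, simp]: "sets PY = sets borel"
    and PY_nonneg: "AE y in PY. 0 \<le> y"
    and PY_sq: "integrable PY (\<lambda>y. y\<^sup>2)"
    and s2_pos: "0 < s2"
    and eps_pos: "0 < eps" and eps_less: "eps < meanY PY"
begin

abbreviation v :: real where "v \<equiv> meanY PY - eps"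

lemma v_pos: "0 < v" using eps_less by simp

sublocale GX: prob_space "gauss v" using v_pos by (rule prob_space_gauss)
sublocale GN: prob_space "gauss s2" using s2_pos by (rule prob_space_gauss)
sublocale XN: pair_prob_space "gauss v" "gauss s2" ..
sublocale YX: pair_prob_space PY "gauss v" ..
sublocale YXN: pair_prob_space PY "gauss v \<Otimes>\<^sub>M gauss s2" ..

lemma integrable_PY: "integrable PY (\<lambda>y. y)"
  by (rule PY.square_integrable_imp_integrable[OF _ PY_sq]) simp

text \<open>Nonnegativity and a finite second moment give the first-order behaviour at
  \<open>\<theta> = 0\<close> without differentiating under the integral.\<close>

lemma PY_exp_moment_le:
  assumes "0 \<le> \<theta>"
  shows "(\<integral>\<^sup>+y. ennreal (exp (- (\<theta> * y))) \<partial>PY)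
    \<le> ennreal (1 - \<theta> * meanY PY + \<theta>\<^sup>2 * (\<integral>y. y\<^sup>2 \<partial>PY) / 2)"
proof -
  define g where "g = (\<lambda>y. 1 - \<theta> * y + \<theta>\<^sup>2 / 2 * y\<^sup>2)"
  have "exp (- (\<theta> * y)) \<le> g y" if "0 \<le> y" for y
    using exp_minus_le_quadratic[of "\<theta> * y"] assms that by (simp add: g_def power_mult_distrib)
  then have AE: "AE y in PY. exp (- (\<theta> * y)) \<le> g y" using PY_nonneg by auto
  then have "(\<integral>\<^sup>+y. ennreal (exp (- (\<theta> * y))) \<partial>PY) \<le> (\<integral>\<^sup>+y. ennreal (g y) \<partial>PY)"
    by (intro nn_integral_mono_AE) (auto intro: ennreal_leI)
  also have "\<dots> = ennreal (\<integral>y. g y \<partial>PY)"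
    using AE PY_sq integrable_PY unfolding g_def
    by (intro nn_integral_eq_integral) (auto elim!: eventually_mono intro: order_trans[OF exp_ge_zero])
  also have "(\<integral>y. g y \<partial>PY) = 1 - \<theta> * meanY PY + \<theta>\<^sup>2 * (\<integral>y. y\<^sup>2 \<partial>PY) / 2"
    using PY_sq integrable_PY by (simp add: g_def meanY_def PY.prob_space)
  finally show ?thesis .
qed

text \<open>Independence bounds the moment by a product \<open>g \<theta>\<close> with
  \<open>g 0 = 1\<close> and slope \<open>- meanY PY + v = - eps < 0\<close> at 0, so it is below 1
  for small positive \<open>\<theta>\<close>.\<close>

lemma drift_exp_moment:
  "\<exists>\<theta> \<rho>. 0 < \<theta> \<and> 0 \<le> \<rho> \<and> \<rho> < 1 \<and>
    (\<integral>\<^sup>+y. \<integral>\<^sup>+x. ennreal (exp (- \<theta> * (y - x\<^sup>2))) \<partial>gauss v \<partial>PY) \<le> ennreal \<rho>"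
proof -
  define K where "K = (\<integral>y. y\<^sup>2 \<partial>PY)"
  define g where "g = (\<lambda>\<theta>. (1 - \<theta> * meanY PY + \<theta>\<^sup>2 * K / 2) / sqrt (1 - 2 * \<theta> * v))"
  have "(g has_real_derivative (- eps)) (at 0)"
    unfolding g_def by (rule derivative_eq_intros refl | simp)+ (simp add: field_simps)
  then obtain d where d: "0 < d" "\<And>h. 0 < h \<Longrightarrow> h < d \<Longrightarrow> g h < g 0"
    using DERIV_neg_dec_right[of g "- eps" 0] eps_pos by auto
  \<comment> \<open>Halving \<open>d\<close> stays strictly inside the range where \<open>g\<close>
    is below \<open>g 0\<close>; the cap \<open>1 / (4 * v)\<close> gives
    \<open>2 * \<theta> * v \<le> 1/2\<close>, so the Gaussian factor is finite.\<close>
  define \<theta> where "\<theta> = min (d / 2) (1 / (4 * v))"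
  have \<theta>: "0 < \<theta>" "\<theta> < d" "2 * \<theta> * v < 1"
  proof -
    show "0 < \<theta>" "\<theta> < d" using d v_pos by (auto simp: \<theta>_def)
    have "\<theta> * v \<le> 1 / (4 * v) * v" using v_pos by (intro mult_right_mono) (auto simp: \<theta>_def)
    also have "\<dots> = 1 / 4" using v_pos by simp
    finally show "2 * \<theta> * v < 1" by simp
  qed
  have "(\<integral>\<^sup>+y. \<integral>\<^sup>+x. ennreal (exp (- \<theta> * (y - x\<^sup>2))) \<partial>gauss v \<partial>PY)
      = (\<integral>\<^sup>+y. \<integral>\<^sup>+x. ennreal (exp (- (\<theta> * y))) * ennreal (exp (\<theta> * x\<^sup>2)) \<partial>gauss v \<partial>PY)"
    by (simp add: ennreal_mult'[symmetric] exp_add[symmetric] algebra_simps)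
  also have "\<dots> = (\<integral>\<^sup>+y. ennreal (exp (- (\<theta> * y))) \<partial>PY) * (\<integral>\<^sup>+x. ennreal (exp (\<theta> * x\<^sup>2)) \<partial>gauss v)"
    by (simp add: nn_integral_cmult nn_integral_multc)
  also have "\<dots> \<le> ennreal (1 - \<theta> * meanY PY + \<theta>\<^sup>2 * K / 2) * ennreal (1 / sqrt (1 - 2 * \<theta> * v))"
    unfolding gauss_exp_moment[OF v_pos \<theta>(3)] K_def using \<theta>(1)
    by (intro mult_right_mono PY_exp_moment_le) auto
  also have "\<dots> = ennreal (g \<theta>)"
    using \<theta>(3) by (simp add: g_def ennreal_mult''[symmetric])
  \<comment> \<open>The maximum with 0 makes \<open>\<rho>\<close> nonnegative whatever the sign of
    \<open>g \<theta>\<close>, and it is still below 1.\<close>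
  also have "\<dots> \<le> ennreal (max 0 (g \<theta>))" by (intro ennreal_leI) simp
  finally show ?thesis
    using \<theta> d(2)[of \<theta>] by (intro exI[of _ \<theta>] exI[of _ "max 0 (g \<theta>)"]) (auto simp: g_def)
qed

section \<open>Exponential moment of the stationary buffer level\<close>

lemma sets_eta_law [measurable_cong, simp]: "sets (eta_law PY eps) = sets borel"
  by (simp add: eta_law_def)

lemma nn_integral_eta_law:
  assumes [measurable]: "f \<in> borel_measurable borel"
  shows "(\<integral>\<^sup>+\<eta>. f \<eta> \<partial>eta_law PY eps) = (\<integral>\<^sup>+y. \<integral>\<^sup>+x. f (y - x\<^sup>2) \<partial>gauss v \<partial>PY)"
  unfolding eta_law_def
  by (subst nn_integral_distr) (auto simp: split_beta' GX.nn_integral_fst[symmetric])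

lemma prob_space_eta_law: "prob_space (eta_law PY eps)"
  unfolding eta_law_def by (rule YX.prob_space_distr) (auto simp: split_beta')

text \<open>The Lyapunov function \<open>exp (- \<theta> * e)\<close> contracts by \<open>\<rho>\<close> in every step, except for the
  overflow at the capacity, which costs at most \<open>exp (- \<theta> * Gam)\<close>.\<close>

lemma stationary_exp_moment_le:
  assumes stat: "stationary_buffer PY eps Gam P"
    and \<theta>: "0 < \<theta>" and \<rho>: "0 \<le> \<rho>" "\<rho> < 1"
    and drift: "(\<integral>\<^sup>+y. \<integral>\<^sup>+x. ennreal (exp (- \<theta> * (y - x\<^sup>2))) \<partial>gauss v \<partial>PY) \<le> ennreal \<rho>"
  shows "(\<integral>\<^sup>+e. ennreal (exp (- \<theta> * e)) \<partial>P) \<le> ennreal (exp (- \<theta> * Gam) / (1 - \<rho>))"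
proof -
  interpret P: prob_space P using stat by (simp add: stationary_buffer_def)
  interpret eta: prob_space "eta_law PY eps" by (rule prob_space_eta_law)
  interpret Pe: pair_prob_space P "eta_law PY eps" ..
  have [measurable_cong, simp]: "sets P = sets borel" using stat by (simp add: stationary_buffer_def)
  have inv: "distr (P \<Otimes>\<^sub>M eta_law PY eps) borel (\<lambda>(e, eta). buf_step Gam e eta) = P"
    and supp: "P {0..Gam} = 1"
    using stat by (auto simp: stationary_buffer_def)
  have [measurable]: "(\<lambda>(e, eta). buf_step Gam e eta) \<in> borel_measurable (borel \<Otimes>\<^sub>M borel)"
    unfolding buf_step_def by measurable
  define F where "F = (\<integral>\<^sup>+e. ennreal (exp (- \<theta> * e)) \<partial>P)"
  have step: "exp (- \<theta> * buf_step Gam e h) \<le> exp (- \<theta> * Gam) + exp (- \<theta> * e) * exp (- \<theta> * h)" for e h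
  proof (cases "Gam \<le> max 0 (e + h)")
    case True
    then show ?thesis by (simp add: buf_step_def min_def)
  next
    case False
    \<comment> \<open>Below capacity only the reflection at 0 acts; it raises the level and so
      lowers the exponential.\<close>
    then have "exp (- \<theta> * buf_step Gam e h) \<le> exp (- \<theta> * (e + h))"
      using \<theta> by (simp add: buf_step_def)
    also have "\<dots> = exp (- \<theta> * e) * exp (- \<theta> * h)" by (simp add: exp_add[symmetric] algebra_simps)
    finally show ?thesis by (simp add: add_increasing)
  qed
  have "F = (\<integral>\<^sup>+z. ennreal (exp (- \<theta> * z)) \<partial>distr (P \<Otimes>\<^sub>M eta_law PY eps) borel (\<lambda>(e, eta). buf_step Gam e eta))"
    unfolding inv F_def ..
  also have "\<dots> = (\<integral>\<^sup>+e. \<integral>\<^sup>+h. ennreal (exp (- \<theta> * buf_step Gam e h)) \<partial>eta_law PY eps \<partial>P)"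
    by (subst nn_integral_distr) (auto simp: split_beta' eta.nn_integral_fst[symmetric])
  also have "\<dots> \<le> (\<integral>\<^sup>+e. \<integral>\<^sup>+h. ennreal (exp (- \<theta> * Gam)) + ennreal (exp (- \<theta> * e)) * ennreal (exp (- \<theta> * h))
      \<partial>eta_law PY eps \<partial>P)"
    using step by (intro nn_integral_mono) (auto simp: ennreal_plus[symmetric] ennreal_mult'[symmetric] simp del: ennreal_plus intro!: ennreal_leI)
  also have "\<dots> = ennreal (exp (- \<theta> * Gam)) + F * (\<integral>\<^sup>+h. ennreal (exp (- \<theta> * h)) \<partial>eta_law PY eps)"
    by (simp add: nn_integral_add nn_integral_cmult nn_integral_multc F_def
        eta.emeasure_space_1 P.emeasure_space_1)
  also have "\<dots> \<le> ennreal (exp (- \<theta> * Gam)) + F * ennreal \<rho>"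
    using drift by (subst nn_integral_eta_law) (auto intro!: add_left_mono mult_left_mono)
  finally have le: "F \<le> ennreal (exp (- \<theta> * Gam)) + F * ennreal \<rho>" .
  \<comment> \<open>The level is nonnegative, so \<open>F \<le> 1\<close>; this finiteness is what
    allows the inequality to be solved for \<open>F\<close>.\<close>
  have "AE e in P. e \<in> {0..Gam}"
    using supp by (intro P.AE_prob_1) (simp add: P.emeasure_eq_measure)
  then have "F \<le> (\<integral>\<^sup>+e. 1 \<partial>P)"
    unfolding F_def using \<theta> by (intro nn_integral_mono_AE) (auto elim!: eventually_mono)
  also have "\<dots> = 1" by (simp add: P.emeasure_space_1)
  finally have "F < \<top>" using ennreal_one_less_top by (rule le_less_trans)
  then obtain r where r: "F = ennreal r" "0 \<le> r" by (cases F) auto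
  have "r \<le> exp (- \<theta> * Gam) + r * \<rho>"
    using le r \<rho> by (simp add: ennreal_mult''[symmetric] ennreal_plus[symmetric] del: ennreal_plus)
  then have "r \<le> exp (- \<theta> * Gam) / (1 - \<rho>)"
    using \<rho> by (simp add: field_simps)
  then show ?thesis using r unfolding F_def by (simp add: ennreal_leI)
qed

end

section \<open>The joint system for a fixed law of the buffer level\<close>

locale tg_system = tg_policy PY s2 eps + P: prob_space P
  for PY :: "real measure" and s2 eps and P :: "real measure" +
  assumes sets_P [measurable_cong, simp]: "sets P = sets borel"
    and P_nonneg: "AE e in P. 0 \<le> e"
begin

abbreviation "M \<equiv> tg_space PY s2 eps P"
abbreviation "X \<equiv> (\<lambda>(e, y, x, n). tg_input e y x) :: real \<times> real \<times> real \<times> real \<Rightarrow> real"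
abbreviation "Z \<equiv> (\<lambda>(e, y, x, n). n) :: real \<times> real \<times> real \<times> real \<Rightarrow> real"

sublocale PYXN: pair_prob_space P "PY \<Otimes>\<^sub>M (gauss v \<Otimes>\<^sub>M gauss s2)" ..

sublocale M: prob_space M
  unfolding tg_space_def by (rule PYXN.prob_space_axioms)

lemma sets_M [measurable_cong]: "sets M = sets (borel \<Otimes>\<^sub>M borel \<Otimes>\<^sub>M borel \<Otimes>\<^sub>M borel)"
  unfolding tg_space_def by (intro sets_pair_measure_cong) auto

lemma tg_input_measurable [measurable]:
  "(\<lambda>z. tg_input (f z) (g z) (h z)) \<in> borel_measurable N"
  if [measurable]: "f \<in> borel_measurable N" "g \<in> borel_measurable N" "h \<in> borel_measurable N"
  unfolding tg_input_def by measurable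

lemma nn_integral_M:
  assumes [measurable]: "f \<in> borel_measurable (borel \<Otimes>\<^sub>M borel \<Otimes>\<^sub>M borel \<Otimes>\<^sub>M borel)"
  shows "(\<integral>\<^sup>+z. f z \<partial>M)
    = (\<integral>\<^sup>+e. \<integral>\<^sup>+y. \<integral>\<^sup>+x. \<integral>\<^sup>+n. f (e, y, x, n) \<partial>gauss s2 \<partial>gauss v \<partial>PY \<partial>P)"
proof -
  have "(\<integral>\<^sup>+z. f z \<partial>M) = (\<integral>\<^sup>+e. \<integral>\<^sup>+z. f (e, z) \<partial>(PY \<Otimes>\<^sub>M (gauss v \<Otimes>\<^sub>M gauss s2)) \<partial>P)"
    unfolding tg_space_def by (subst YXN.nn_integral_fst[symmetric]) auto
  also have "\<dots> = (\<integral>\<^sup>+e. \<integral>\<^sup>+y. \<integral>\<^sup>+z. f (e, y, z) \<partial>(gauss v \<Otimes>\<^sub>M gauss s2) \<partial>PY \<partial>P)"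
    by (intro nn_integral_cong XN.nn_integral_fst[symmetric]) auto
  also have "\<dots> = (\<integral>\<^sup>+e. \<integral>\<^sup>+y. \<integral>\<^sup>+x. \<integral>\<^sup>+n. f (e, y, x, n) \<partial>gauss s2 \<partial>gauss v \<partial>PY \<partial>P)"
    by (intro nn_integral_cong GN.nn_integral_fst[symmetric]) auto
  finally show ?thesis .
qed

text \<open>\<open>X\<close> is a function of the first three coordinates, so the noise coordinate
  can be integrated out with the value of \<open>X\<close> held fixed.\<close>

lemma independent_noise:
  "distr M (borel \<Otimes>\<^sub>M borel) (\<lambda>\<omega>. (X \<omega>, Z \<omega>)) = distr M borel X \<Otimes>\<^sub>M gauss s2" (is "?L = ?R")
proof (rule measure_eqI)
  show "sets ?L = sets ?R" by (simp cong: sets_pair_measure_cong)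
next
  fix A assume "A \<in> sets ?L"
  then have A [measurable]: "A \<in> sets (borel \<Otimes>\<^sub>M borel)" by simp
  have "emeasure ?L A = (\<integral>\<^sup>+\<omega>. indicator A (X \<omega>, Z \<omega>) \<partial>M)"
    unfolding nn_integral_indicator[OF \<open>A \<in> sets ?L\<close>, symmetric]
    by (subst nn_integral_distr) (auto simp: split_beta')
  also have "\<dots> = (\<integral>\<^sup>+e. \<integral>\<^sup>+y. \<integral>\<^sup>+x. \<integral>\<^sup>+n. indicator A (tg_input e y x, n) \<partial>gauss s2 \<partial>gauss v \<partial>PY \<partial>P)"
    by (subst nn_integral_M) (auto simp: split_beta')
  also have "\<dots> = (\<integral>\<^sup>+\<omega>. (\<integral>\<^sup>+n. indicator A (X \<omega>, n) \<partial>gauss s2) \<partial>M)"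
    by (subst nn_integral_M) (auto simp: split_beta' GN.emeasure_space_1[simplified])
  also have "\<dots> = (\<integral>\<^sup>+x. \<integral>\<^sup>+n. indicator A (x, n) \<partial>gauss s2 \<partial>distr M borel X)"
    by (subst nn_integral_distr) (auto simp: split_beta')
  also have "\<dots> = (\<integral>\<^sup>+z. indicator A z \<partial>?R)"
    by (rule GN.nn_integral_fst) measurable
  also have "\<dots> = emeasure ?R A"
    by (rule nn_integral_indicator) (simp cong: sets_pair_measure_cong)
  finally show "emeasure ?L A = emeasure ?R A" .
qed

lemma input_power:
  "integrable M (\<lambda>\<omega>. (X \<omega>)\<^sup>2)" "(\<integral>\<omega>. (X \<omega>)\<^sup>2 \<partial>M) \<le> v"
proof -
  \<comment> \<open>Truncation shrinks the modulus. The signs matter: \<open>sqrt\<close> of a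
    negative number is negative, and the minimum could then exceed \<open>\<bar>x\<bar>\<close> in
    modulus.\<close>
  have le: "(tg_input e y x)\<^sup>2 \<le> x\<^sup>2" if "0 \<le> e" "0 \<le> y" for e y x
  proof -
    have "\<bar>tg_input e y x\<bar> \<le> \<bar>x\<bar>"
      using that by (auto simp: tg_input_def sgn_if abs_mult)
    then show ?thesis by (simp add: abs_le_square_iff)
  qed
  have "(\<integral>\<^sup>+\<omega>. ennreal ((X \<omega>)\<^sup>2) \<partial>M)
      = (\<integral>\<^sup>+e. \<integral>\<^sup>+y. \<integral>\<^sup>+x. \<integral>\<^sup>+n. ennreal ((tg_input e y x)\<^sup>2) \<partial>gauss s2 \<partial>gauss v \<partial>PY \<partial>P)"
    by (subst nn_integral_M) (auto simp: split_beta')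
  also have "\<dots> \<le> (\<integral>\<^sup>+e. \<integral>\<^sup>+y. \<integral>\<^sup>+x. \<integral>\<^sup>+n. ennreal (x\<^sup>2) \<partial>gauss s2 \<partial>gauss v \<partial>PY \<partial>P)"
  proof (rule nn_integral_mono_AE, use P_nonneg in eventually_elim,
      rule nn_integral_mono_AE, use PY_nonneg in eventually_elim)
    fix e y :: real assume "0 \<le> e" "0 \<le> y"
    then show "(\<integral>\<^sup>+x. \<integral>\<^sup>+n. ennreal ((tg_input e y x)\<^sup>2) \<partial>gauss s2 \<partial>gauss v)
        \<le> (\<integral>\<^sup>+x. \<integral>\<^sup>+n. ennreal (x\<^sup>2) \<partial>gauss s2 \<partial>gauss v)"
      by (intro nn_integral_mono ennreal_leI le)
  qed
  also have "\<dots> = (\<integral>\<^sup>+x. ennreal (x\<^sup>2) \<partial>gauss v)"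
    using GN.emeasure_space_1 PY.emeasure_space_1 P.emeasure_space_1 by simp
  also have "\<dots> = ennreal v"
    using gauss_second_moment[OF v_pos]
    by (subst nn_integral_eq_integral) (auto simp: has_bochner_integral_iff)
  finally have *: "(\<integral>\<^sup>+\<omega>. ennreal ((X \<omega>)\<^sup>2) \<partial>M) \<le> ennreal v" .
  show i: "integrable M (\<lambda>\<omega>. (X \<omega>)\<^sup>2)"
    using * by (intro integrableI_bounded) (auto simp: split_beta' intro: le_less_trans)
  show "(\<integral>\<omega>. (X \<omega>)\<^sup>2 \<partial>M) \<le> v"
    using * v_pos by (subst (asm) nn_integral_eq_integral[OF i]) auto
qed

lemma measurable_X [measurable]: "X \<in> borel_measurable M"
  and measurable_Z [measurable]: "Z \<in> borel_measurable M"
  by (auto simp: split_beta')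

sublocale ch: gaussian_channel "distr M borel X" "sqrt s2"
  using s2_pos input_power(1)
  by (intro gaussian_channel.intro gaussian_channel_axioms.intro M.prob_space_distr)
     (simp_all add: integrable_distr_eq)

lemma rate_eq: "tg_rate PY s2 eps P = ch.out_entropy - (ln (2 * pi * s2) / 2 + 1 / 2)"
proof -
  have eq: "(\<lambda>\<omega>. X \<omega> + Z \<omega>) = (\<lambda>(e, y, x, n). tg_input e y x + n)"
    by (auto simp: fun_eq_iff)
  have s: "(sqrt s2)\<^sup>2 = s2" using s2_pos by simp
  show ?thesis
    using M.mutual_information_additive_gaussian[OF measurable_X measurable_Z real_sqrt_gt_zero[OF s2_pos]
        input_power(1) independent_noise[unfolded gauss_def]]
    unfolding tg_rate_def eq s .
qed

lemma rate_le: "tg_rate PY s2 eps P \<le> 1/2 * ln (1 + v / s2)"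
proof -
  have "ch.in_power \<le> v"
    unfolding ch.in_power_def using input_power(2) by (subst integral_distr) auto
  from ch.out_entropy_le[OF this]
  have "tg_rate PY s2 eps P \<le> ln (2 * pi * (v + s2)) / 2 - ln (2 * pi * s2) / 2"
    using s2_pos by (simp add: rate_eq)
  also have "\<dots> = 1/2 * ln (1 + v / s2)"
    using v_pos s2_pos by (rule ln_capacity)
  finally show ?thesis .
qed

text \<open>Coupling: \<open>X\<close> and \<open>X'\<close> live on the same space and differ only
  if \<open>e + y - x\<^sup>2 < 0\<close>. There the kernels differ by at most the noise peak, and
  the exponential bound on this event factors by independence of the buffer level and (Y,
  X').\<close>

lemma density_close:
  fixes \<theta> :: real
  assumes \<theta>: "0 < \<theta>"
    and F: "(\<integral>\<^sup>+e. ennreal (exp (- \<theta> * e)) \<partial>P) \<le> ennreal a" "0 \<le> a"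
    and \<rho>: "(\<integral>\<^sup>+y. \<integral>\<^sup>+x. ennreal (exp (- \<theta> * (y - x\<^sup>2))) \<partial>gauss v \<partial>PY) \<le> ennreal \<rho>" "0 \<le> \<rho>"
  shows "\<bar>ch.out_density w - gaussian_channel.out_density (gauss v) (sqrt s2) w\<bar>
    \<le> 1 / sqrt (2 * pi * s2) * (a * \<rho>)"
proof -
  interpret g: gaussian_channel "gauss v" "sqrt s2"
    using v_pos s2_pos by (intro gaussian_channel_gauss) auto
  define C where "C = 1 / sqrt (2 * pi * s2)"
  let ?n = "\<lambda>x. normal_density x (sqrt s2) w"
  let ?X' = "\<lambda>(e, y, x, n). x :: real"
  let ?d = "\<lambda>(e, y, x, n). C * (exp (- \<theta> * e) * exp (- \<theta> * (y - x\<^sup>2)))"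
  have C: "0 \<le> C" "?n x \<le> C" "0 \<le> ?n x" for x
    using normal_density_le[of "sqrt s2" x w] s2_pos by (auto simp: C_def)
  have bound: "\<bar>?n (tg_input e y x) - ?n x\<bar> \<le> C * (exp (- \<theta> * e) * exp (- \<theta> * (y - x\<^sup>2)))" for e y x
  proof (cases "x\<^sup>2 \<le> e + y")
    case True
    then have "\<bar>x\<bar> \<le> sqrt (e + y)" by (simp add: real_le_rsqrt)
    then have "tg_input e y x = x" by (simp add: tg_input_def min_absorb2 sgn_mult_abs)
    then show ?thesis using C by simp
  next
    case False
    \<comment> \<open>On truncation the exponential is at least 1, while both kernel values lie in
      \<open>[0, C]\<close> and so differ by at most \<open>C\<close>.\<close>
    then have "0 \<le> - \<theta> * (e + y - x\<^sup>2)" using \<theta> by (simp add: mult_nonneg_nonpos)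
    then have "C * 1 \<le> C * exp (- \<theta> * (e + y - x\<^sup>2))" using C by (intro mult_left_mono) auto
    also have "exp (- \<theta> * (e + y - x\<^sup>2)) = exp (- \<theta> * e) * exp (- \<theta> * (y - x\<^sup>2))"
      by (simp add: exp_add[symmetric] algebra_simps)
    finally show ?thesis using C(2,3)[of x] C(2,3)[of "tg_input e y x"] by linarith
  qed
  have "(\<integral>\<^sup>+z. ennreal (?d z) \<partial>M)
      = (\<integral>\<^sup>+e. \<integral>\<^sup>+y. \<integral>\<^sup>+x. \<integral>\<^sup>+n. ennreal C * (ennreal (exp (- \<theta> * e)) * ennreal (exp (- \<theta> * (y - x\<^sup>2))))
        \<partial>gauss s2 \<partial>gauss v \<partial>PY \<partial>P)"
    using C by (subst nn_integral_M) (auto simp: split_beta' ennreal_mult)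
  also have "\<dots> = ennreal C * ((\<integral>\<^sup>+e. ennreal (exp (- \<theta> * e)) \<partial>P)
      * (\<integral>\<^sup>+y. \<integral>\<^sup>+x. ennreal (exp (- \<theta> * (y - x\<^sup>2))) \<partial>gauss v \<partial>PY))"
    using GN.emeasure_space_1 by (simp add: nn_integral_cmult nn_integral_multc)
  also have "\<dots> \<le> ennreal C * (ennreal a * ennreal \<rho>)"
    by (intro mult_left_mono mult_mono F \<rho>) auto
  also have "\<dots> = ennreal (C * (a * \<rho>))"
    using C F \<rho> by (simp add: ennreal_mult)
  finally have D: "(\<integral>\<^sup>+z. ennreal (?d z) \<partial>M) \<le> ennreal (C * (a * \<rho>))" .
  have d0: "0 \<le> ?d z" for z using C by (simp add: split_beta')
  have di: "integrable M ?d"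
    using D d0 by (intro integrableI_bounded) (auto simp: split_beta' intro: le_less_trans)
  have dI: "integral\<^sup>L M ?d \<le> C * (a * \<rho>)"
    using D C F \<rho> d0 by (subst (asm) nn_integral_eq_integral[OF di]) auto
  have [measurable]: "?X' \<in> borel_measurable M" by (auto simp: split_beta')
  have nX: "integrable M (\<lambda>z. ?n (X z))" "integrable M (\<lambda>z. ?n (?X' z))"
    using C by (auto intro!: M.integrable_const_bound[where B = C])
  \<comment> \<open>With this law for the third coordinate, both output densities are expectations
    on the same space \<open>M\<close>.\<close>
  have X': "distr M borel ?X' = gauss v"
  proof (rule measure_eqI)
    fix A assume "A \<in> sets (distr M borel ?X')"
    then have A [measurable]: "A \<in> sets borel" by simp
    have "emeasure (distr M borel ?X') A = (\<integral>\<^sup>+z. indicator A (?X' z) \<partial>M)"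
      by (subst nn_integral_indicator[symmetric], simp) (rule nn_integral_distr; simp)
    also have "\<dots> = emeasure (gauss v) A"
      using GN.emeasure_space_1 PY.emeasure_space_1 P.emeasure_space_1
      by (subst nn_integral_M) (auto simp: split_beta')
    finally show "emeasure (distr M borel ?X') A = emeasure (gauss v) A" .
  qed simp
  have "ch.out_density w - g.out_density w = (\<integral>z. ?n (X z) \<partial>M) - (\<integral>z. ?n (?X' z) \<partial>M)"
    unfolding ch.out_density_def g.out_density_def
    by (subst X'[symmetric], subst (1 2) integral_distr) auto
  also have "\<dots> = (\<integral>z. ?n (X z) - ?n (?X' z) \<partial>M)"
    using nX by simp
  finally have "\<bar>ch.out_density w - g.out_density w\<bar> = \<bar>\<integral>z. ?n (X z) - ?n (?X' z) \<partial>M\<bar>"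
    by (rule arg_cong)
  also have "\<dots> \<le> (\<integral>z. \<bar>?n (X z) - ?n (?X' z)\<bar> \<partial>M)"
    by (rule integral_abs_bound)
  also have "\<dots> \<le> integral\<^sup>L M ?d"
  proof (rule integral_mono)
    show "integrable M (\<lambda>z. \<bar>?n (X z) - ?n (?X' z)\<bar>)"
      by (intro integrable_abs Bochner_Integration.integrable_diff nX)
    show "\<bar>?n (X z) - ?n (?X' z)\<bar> \<le> ?d z" for z
      using bound by (cases z) simp
  qed (rule di)
  finally show ?thesis using dI by (simp add: C_def)
qed

end

section \<open>Limits for large buffers\<close>

lemma (in tg_policy) tg_system_stationary:
  assumes stat: "stationary_buffer PY eps Gam P"
  shows "tg_system PY s2 eps P"
proof -
  interpret P: prob_space P using stat by (simp add: stationary_buffer_def)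
  have "AE e in P. e \<in> {0..Gam}"
    using stat by (intro P.AE_prob_1) (simp add: stationary_buffer_def P.emeasure_eq_measure)
  then show ?thesis
    using stat by unfold_locales (auto simp: stationary_buffer_def)
qed

text \<open>\<open>\<theta>\<close> and \<open>\<rho>\<close> are chosen before \<open>Gam\<close>,
  so the bound on the density distance decays like \<open>exp (- \<theta> * Gam)\<close> and falls
  below the tolerance \<open>d\<close> given by semicontinuity of the entropy.\<close>

lemma (in tg_policy) eventually_rate_greater:
  assumes stat: "\<And>Gam. 0 < Gam \<Longrightarrow> stationary_buffer PY eps Gam (P Gam)"
    and c: "c < 1/2 * ln (1 + v / s2)"
  shows "\<forall>\<^sub>F Gam in at_top. c < tg_rate PY s2 eps (P Gam)"
proof -
  obtain \<theta> \<rho> where \<theta>: "0 < \<theta>" and \<rho>: "0 \<le> \<rho>" "\<rho> < 1"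
    and drift: "(\<integral>\<^sup>+y. \<integral>\<^sup>+x. ennreal (exp (- \<theta> * (y - x\<^sup>2))) \<partial>gauss v \<partial>PY) \<le> ennreal \<rho>"
    using drift_exp_moment by blast
  let ?s = "sqrt s2" and ?\<kappa> = "ln (2 * pi * s2) / 2 + 1 / 2"
  have g: "gaussian_channel (gauss v) ?s"
    using v_pos s2_pos by (intro gaussian_channel_gauss) auto
  \<comment> \<open>\<open>?\<kappa>\<close> is the noise entropy; adding it turns the bound on
    rates into one on output entropies.\<close>
  have "c + ?\<kappa> < gaussian_channel.out_entropy (gauss v) ?s"
    using c ln_capacity[OF v_pos s2_pos] v_pos s2_pos by (simp add: out_entropy_gauss)
  from out_entropy_lower_semicontinuous[OF g this]
  obtain d where d: "0 < d"
    and lsc: "\<And>\<mu>. gaussian_channel \<mu> ?s \<Longrightarrow>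
      (\<And>w. \<bar>gaussian_channel.out_density \<mu> ?s w - gaussian_channel.out_density (gauss v) ?s w\<bar> \<le> d) \<Longrightarrow>
      c + ?\<kappa> < gaussian_channel.out_entropy \<mu> ?s"
    by blast
  let ?a = "\<lambda>Gam. exp (- \<theta> * Gam) / (1 - \<rho>)"
  have "((\<lambda>Gam. exp (- \<theta> * Gam)) \<longlongrightarrow> 0) at_top"
    using \<theta> by (intro filterlim_compose[OF exp_at_bot] filterlim_tendsto_neg_mult_at_bot[OF tendsto_const])
      (auto simp: filterlim_ident)
  then have "((\<lambda>Gam. 1 / sqrt (2 * pi * s2) * \<rho> / (1 - \<rho>) * exp (- \<theta> * Gam)) \<longlongrightarrow> 0) at_top"
    by (rule tendsto_mult_right_zero)
  then have "((\<lambda>Gam. 1 / sqrt (2 * pi * s2) * (?a Gam * \<rho>)) \<longlongrightarrow> 0) at_top"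
    by (simp add: mult_ac)
  from order_tendstoD(2)[OF this d]
  have small: "\<forall>\<^sub>F Gam in at_top. 1 / sqrt (2 * pi * s2) * (?a Gam * \<rho>) < d" .
  show ?thesis
    using small eventually_gt_at_top[of "0::real"]
  proof eventually_elim
    fix Gam :: real assume small: "1 / sqrt (2 * pi * s2) * (?a Gam * \<rho>) < d" and Gam: "0 < Gam"
    interpret S: tg_system PY s2 eps "P Gam" using stat[OF Gam] by (rule tg_system_stationary)
    note F = stationary_exp_moment_le[OF stat[OF Gam] \<theta> \<rho> drift]
    have "c + ?\<kappa> < S.ch.out_entropy"
    proof (rule lsc)
      show "gaussian_channel (distr S.M borel S.X) ?s" by (rule S.ch.gaussian_channel_axioms)
      show "\<bar>S.ch.out_density w - gaussian_channel.out_density (gauss v) ?s w\<bar> \<le> d" for w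
        using S.density_close[OF \<theta> F _ drift \<rho>(1), of w] \<rho> small by auto
    qed
    then show "c < tg_rate PY s2 eps (P Gam)" by (simp add: S.rate_eq)
  qed
qed

theorem theorem2:
  fixes PY :: "real measure" and s2 :: real
    and \<pi> :: "real \<Rightarrow> real \<Rightarrow> real measure"
  assumes PY_prob: "prob_space PY"
    and PY_sets: "sets PY = sets borel"
    and PY_nonneg: "AE y in PY. 0 \<le> y"
    and PY_sq: "integrable PY (\<lambda>y. y\<^sup>2)"
    and PY_mean: "meanY PY > 0"
    and s2_pos: "s2 > 0"
    and pi_stat: "\<And>eps Gam. 0 < eps \<Longrightarrow> eps < meanY PY \<Longrightarrow> 0 < Gam \<Longrightarrow>
                   stationary_buffer PY eps Gam (\<pi> eps Gam)"
  shows "(\<forall>eps. 0 < eps \<and> eps < meanY PY \<longrightarrow>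
           ereal (1/2 * ln (1 + (meanY PY - eps) / s2))
             \<le> Liminf at_top (\<lambda>Gam. ereal (tg_rate PY s2 eps (\<pi> eps Gam)))) \<and>
         ((\<lambda>Gam. SUP eps \<in> {0<..<meanY PY}. tg_rate PY s2 eps (\<pi> eps Gam))
            \<longlongrightarrow> 1/2 * ln (1 + meanY PY / s2)) at_top"
proof
  let ?m = "meanY PY" and ?r = "\<lambda>eps Gam. tg_rate PY s2 eps (\<pi> eps Gam)"
  let ?C = "\<lambda>eps. 1/2 * ln (1 + (?m - eps) / s2)"
  have pol: "tg_policy PY s2 eps" if "0 < eps" "eps < ?m" for eps
    using assms that by (simp add: tg_policy_def tg_policy_axioms_def)
  have low: "\<forall>\<^sub>F Gam in at_top. c < ?r eps Gam" if "0 < eps" "eps < ?m" "c < ?C eps" for eps c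
    using tg_policy.eventually_rate_greater[OF pol pi_stat] that by blast
  show "\<forall>eps. 0 < eps \<and> eps < ?m \<longrightarrow> ereal (?C eps) \<le> Liminf at_top (\<lambda>Gam. ereal (?r eps Gam))"
  proof (intro allI impI, unfold le_Liminf_iff, intro allI impI)
    fix eps y assume eps: "0 < eps \<and> eps < ?m" and y: "y < ereal (?C eps)"
    show "\<forall>\<^sub>F Gam in at_top. y < ereal (?r eps Gam)"
    \<comment> \<open>Only finite \<open>y\<close> has content: \<infinity> is not below a real, and
      -\<infinity> is below every real.\<close>
    proof (cases y)
      case (real c)
      then show ?thesis using low[of eps c] eps y by simp
    qed (use y in auto)
  qed
  \<comment> \<open>Dropping \<open>eps\<close> makes the bound uniform, as the supremum
    requires.\<close>
  have up: "?r eps Gam \<le> 1/2 * ln (1 + ?m / s2)" if "0 < eps" "eps < ?m" "0 < Gam" for eps Gam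
  proof -
    interpret tg_policy PY s2 eps using that by (intro pol)
    interpret tg_system PY s2 eps "\<pi> eps Gam"
      using pi_stat[OF that] by (rule tg_system_stationary)
    have "?r eps Gam \<le> ?C eps" by (rule rate_le)
    also have "\<dots> \<le> 1/2 * ln (1 + ?m / s2)"
      using that s2_pos v_pos by (intro mult_left_mono ln_mono add_left_mono divide_right_mono add_pos_pos) auto
    finally show ?thesis .
  qed
  \<comment> \<open>A real supremum is known to dominate its elements only for sets bounded
    above.\<close>
  have bdd: "bdd_above ((\<lambda>eps. ?r eps Gam) ` {0<..<?m})" if "0 < Gam" for Gam
    using up that by (intro bdd_aboveI2[where M = "1/2 * ln (1 + ?m / s2)"]) auto
  show "((\<lambda>Gam. SUP eps \<in> {0<..<?m}. ?r eps Gam) \<longlongrightarrow> 1/2 * ln (1 + ?m / s2)) at_top"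
  proof (rule order_tendstoI)
    fix c assume c: "c < 1/2 * ln (1 + ?m / s2)"
    \<comment> \<open>Letting \<open>eps\<close> tend to 0 from the right yields one fixed
      \<open>eps\<close> with \<open>c < ?C eps\<close>; the supremum is at least the rate at this
      \<open>eps\<close>.\<close>
    have "(?C \<longlongrightarrow> 1/2 * ln (1 + (?m - 0) / s2)) (at_right 0)"
      using PY_mean s2_pos by (intro tendsto_intros) (auto simp: add_pos_pos less_imp_neq[symmetric])
    then have "\<forall>\<^sub>F eps in at_right 0. c < ?C eps"
      using c by (intro order_tendstoD) auto
    then have "\<forall>\<^sub>F eps in at_right 0. c < ?C eps \<and> 0 < eps \<and> eps < ?m"
      using eventually_at_right_less[of "0::real"] eventually_at_right_real[OF PY_mean]
      by eventually_elim auto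
    then obtain eps where eps: "c < ?C eps" "0 < eps" "eps < ?m"
      using eventually_happens'[OF trivial_limit_at_right_real] by blast
    from low[OF eps(2,3,1)] eventually_gt_at_top[of 0]
    show "\<forall>\<^sub>F Gam in at_top. c < (SUP eps \<in> {0<..<?m}. ?r eps Gam)"
    proof eventually_elim
      case (elim Gam)
      then show ?case using eps cSUP_upper[OF _ bdd, of eps Gam] by auto
    qed
  next
    fix c assume c: "1/2 * ln (1 + ?m / s2) < c"
    show "\<forall>\<^sub>F Gam in at_top. (SUP eps \<in> {0<..<?m}. ?r eps Gam) < c"
      using eventually_gt_at_top[of 0]
    proof eventually_elim
      case (elim Gam)
      then have "(SUP eps \<in> {0<..<?m}. ?r eps Gam) \<le> 1/2 * ln (1 + ?m / s2)"
        using PY_mean up by (intro cSUP_least) auto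
      then show ?case using c by simp
    qed
  qed
qed

end
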